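(* Let $V$ be a valuation ring of rank one with quotient field $K$ and with uncountable value group. Then $\mathcal{V}$ (endowed with the Zariski topology) and $\mathrm{Zar}(K(X)|V)^{\mathrm{cons}}$ are not metrizable.
   Context: $\mathrm{Zar}(K(X)|V)$ is the set of valuation domains of $K(X)$ (with quotient field $K(X)$) containing $V$. Its Zariski topology is generated by the subbasic open sets $B(\phi)=\{W\mid\phi\in W\}$, $\phi\in K(X)$; its constructible topology is the coarsest topology for which all sets $B(\phi_1)\cap\cdots\cap B(\phi_k)$ are both open and closed. $\mathrm{Zar}(K(X)|V)^{\mathrm{cons}}$ is this set with the constructible topology. $v$ is the valuation associated to $V$. A sequence $E=\{s_n\}_{n\in\mathbb{N}}$ in $K$ is pseudo-convergent if $v(s_{n+1}-s_n)<v(s_{n+2}-s_{n+1})$ for all $n$. $V_E=\{\phi\in K(X)\mid \phi(s_n)\in V\text{ for all but finitely many }n\in\mathbb{N}\}$ is a valuation domain of $K(X)$ with $V_E\cap K=V$. $\mathcal{V}\subseteq\mathrm{Zar}(K(X)|V)$ is the set of all rings $V_E$, $E$ a pseudo-convergent sequence in $K$. *)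

theory Defs
  imports
    "HOL-Analysis.Abstract_Metric_Spaces"
    "HOL-Computational_Algebra.Fraction_Field"
    "HOL-Computational_Algebra.Polynomial"
    "HOL-Library.Extended_Nat"
    "HOL-Algebra.Coset"
begin

text \<open>The field K is the whole type \<open>'a :: field\<close>, and K(X) is the type \<open>'a poly fract\<close>.\<close>

text \<open>Valuation domains having the ambient field as quotient field; a field is a valuation
  domain of itself.\<close>

definition valuation_domain :: "'k::field set \<Rightarrow> bool" where
  "valuation_domain W \<longleftrightarrow>
     1 \<in> W \<and> (\<forall>x\<in>W. \<forall>y\<in>W. x - y \<in> W \<and> x * y \<in> W) \<and>
     (\<forall>x. x \<noteq> 0 \<longrightarrow> x \<in> W \<or> inverse x \<in> W)"

definition field_mult_group :: "'k::field monoid" where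
  "field_mult_group = \<lparr>carrier = - {0}, monoid.mult = (*), one = 1\<rparr>"

definition unit_group :: "'k::field set \<Rightarrow> 'k set" where
  "unit_group V = {u \<in> V. u \<noteq> 0 \<and> inverse u \<in> V}"

definition value_group :: "'k::field set \<Rightarrow> 'k set monoid" where
  "value_group V = field_mult_group Mod unit_group V"

text \<open>The valuation associated to V sends x to its class modulo the units of V. On nonzero
  elements it takes values in the (multiplicatively written) \<^term>\<open>value_group V\<close>;
  \<open>val V 0 = {0}\<close> plays the role of infinity and is the top element for \<open>val_le V\<close>.\<close>

definition val :: "'k::field set \<Rightarrow> 'k \<Rightarrow> 'k set" where
  "val V x = (\<lambda>u. u * x) ` unit_group V"

definition val_le :: "'k::field set \<Rightarrow> 'k set \<Rightarrow> 'k set \<Rightarrow> bool" where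
  "val_le V \<alpha> \<beta> \<longleftrightarrow> (\<forall>b\<in>\<beta>. \<exists>a\<in>\<alpha>. \<exists>c\<in>V. b = c * a)"

definition val_less :: "'k::field set \<Rightarrow> 'k set \<Rightarrow> 'k set \<Rightarrow> bool" where
  "val_less V \<alpha> \<beta> \<longleftrightarrow> val_le V \<alpha> \<beta> \<and> \<alpha> \<noteq> \<beta>"

definition convex_subgroup :: "'k::field set \<Rightarrow> 'k set set \<Rightarrow> bool" where
  "convex_subgroup V H \<longleftrightarrow> subgroup H (value_group V) \<and>
     (\<forall>\<alpha>\<in>H. \<forall>\<gamma>\<in>H. \<forall>\<beta>\<in>carrier (value_group V).
        val_le V \<alpha> \<beta> \<and> val_le V \<beta> \<gamma> \<longrightarrow> \<beta> \<in> H)"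

text \<open>The rank is the number of proper convex subgroups of the value group; the trivial
  subgroup counts unless the value group is itself trivial.\<close>

definition valuation_rank :: "'k::field set \<Rightarrow> enat" where
  "valuation_rank V =
     (let \<C> = {H. convex_subgroup V H \<and> H \<noteq> carrier (value_group V)}
      in if finite \<C> then enat (card \<C>) else \<infinity>)"

definition ratfun_const :: "'a::field \<Rightarrow> 'a poly fract" where
  "ratfun_const c = Fract [:c:] 1"

definition Zar :: "'a::field set \<Rightarrow> 'a poly fract set set" where
  "Zar V = {W. valuation_domain W \<and> ratfun_const ` V \<subseteq> W}"

definition Zar_B :: "'a::field set \<Rightarrow> 'a poly fract \<Rightarrow> 'a poly fract set set" where
  "Zar_B V \<phi> = {W \<in> Zar V. \<phi> \<in> W}"

definition zariski_topology :: "'a::field set \<Rightarrow> 'a poly fract set topology" where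
  "zariski_topology V = topology_generated_by (range (Zar_B V))"

definition constructible_topology :: "'a::field set \<Rightarrow> 'a poly fract set topology" where
  "constructible_topology V = topology_generated_by
     (\<Union>F \<in> {F. finite F \<and> F \<noteq> {}}.
        {\<Inter>\<phi>\<in>F. Zar_B V \<phi>, Zar V - (\<Inter>\<phi>\<in>F. Zar_B V \<phi>)})"

definition pseudo_convergent :: "'a::field set \<Rightarrow> (nat \<Rightarrow> 'a) \<Rightarrow> bool" where
  "pseudo_convergent V s \<longleftrightarrow>
     (\<forall>n. val_less V (val V (s (n + 1) - s n)) (val V (s (n + 2) - s (n + 1))))"

text \<open>\<open>ratfun_has_value \<phi> x a\<close>: the rational function \<open>\<phi>\<close> has no pole at x and
  \<open>\<phi>(x) = a\<close>.\<close>

definition ratfun_has_value :: "'a::field poly fract \<Rightarrow> 'a \<Rightarrow> 'a \<Rightarrow> bool" where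
  "ratfun_has_value \<phi> x a \<longleftrightarrow>
     (\<exists>p q. \<phi> = Fract p q \<and> poly q x \<noteq> 0 \<and> a = poly p x / poly q x)"

definition pc_domain :: "'a::field set \<Rightarrow> (nat \<Rightarrow> 'a) \<Rightarrow> 'a poly fract set" where
  "pc_domain V s = {\<phi>. \<forall>\<^sub>\<infinity>n. \<exists>a\<in>V. ratfun_has_value \<phi> (s n) a}"

definition pc_domains :: "'a::field set \<Rightarrow> 'a poly fract set set" where
  "pc_domains V = {pc_domain V s | s. pseudo_convergent V s}"

end

theory Submission
  imports Defs
begin

text \<open>
  As V has rank one, its value group is archimedean, and as it is uncountable there are \<open>d\<^sub>n\<close>
  in K whose values are positive and strictly decrease to 0. For nonzero c the sequence
  \<open>c / d\<^sub>n\<close> is pseudo-convergent with values increasing to \<open>v c\<close>; let \<open>W\<^sub>c\<close> be its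
  domain. For x with \<open>v x\<close> slightly below \<open>v c\<close> a rational function has the value of a monomial
  \<open>a x\<^sup>k\<close>, so every set open in the Zariski or the constructible topology that contains \<open>W\<^sub>c\<close>
  contains all \<open>W\<^sub>b\<close> with \<open>v b\<close> in some interval \<open>(v t, v c]\<close>. Hence the \<open>W\<^sub>c\<close> form a separable
  space. But \<open>c / X\<close> lies in \<open>W\<^sub>b\<close> exactly if \<open>v b \<le> v c\<close>; as for the Sorgenfrey line, a
  separable metrizable space cannot contain uncountably many points separated in this way.
\<close>

section \<open>A separation criterion in metrizable spaces\<close>

text \<open>Each \<open>i\<close> receives an \<open>n\<close> such that \<open>U i\<close> contains
  the ball of radius \<open>2 / (n + 1)\<close> about \<open>f i\<close>, and a point of
  \<open>D\<close> at distance below \<open>1 / (n + 1)\<close> from \<open>f i\<close>. If two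
  indices shared both data, their points would be closer than \<open>2 / (n + 1)\<close> and each
  would lie in the other's neighbourhood, against \<open>sep\<close>. Hence \<open>I\<close> injects
  into pairs of a natural number and a point of \<open>D\<close>.\<close>

lemma metrizable_countable_left_separated:
  assumes T: "metrizable_space T" and D: "countable D"
    and dense: "\<And>U. openin T U \<Longrightarrow> U \<noteq> {} \<Longrightarrow> U \<inter> D \<noteq> {}"
    and U: "\<And>i. i \<in> I \<Longrightarrow> openin T (U i) \<and> f i \<in> U i"
    and sep: "\<And>i j. i \<in> I \<Longrightarrow> j \<in> I \<Longrightarrow> i \<noteq> j \<Longrightarrow> f j \<notin> U i \<or> f i \<notin> U j"
  shows "countable I"
proof -
  obtain M d where Md: "Metric_space M d" and Teq: "T = Metric_space.mtopology M d"
    using T unfolding metrizable_space_def by blast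
  interpret Metric_space M d by (rule Md)
  have "\<exists>n x. x \<in> D \<and> x \<in> mball (f i) (1 / real (Suc n)) \<and> mball (f i) (2 / real (Suc n)) \<subseteq> U i"
    if i: "i \<in> I" for i
  proof -
    have "f i \<in> M" "\<exists>r>0. mball (f i) r \<subseteq> U i"
      using U[OF i] unfolding Teq openin_mtopology by auto
    then obtain r where r: "r > 0" "mball (f i) r \<subseteq> U i" by blast
    obtain n where n: "1 / real (Suc n) < r / 2" using r(1) nat_approx_posE[of "r/2"] by auto
    have "f i \<in> mball (f i) (1 / real (Suc n))" using \<open>f i \<in> M\<close> by simp
    then have "mball (f i) (1 / real (Suc n)) \<inter> D \<noteq> {}"
      by (intro dense) (auto simp only: Teq openin_mball)
    moreover have "mball (f i) (2 / real (Suc n)) \<subseteq> mball (f i) r"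
      using n by (intro mball_subset_concentric) (simp add: field_simps)
    ultimately show ?thesis using r(2) by blast
  qed
  then obtain n x where nx: "\<And>i. i \<in> I \<Longrightarrow> x i \<in> D \<and> x i \<in> mball (f i) (1 / real (Suc (n i)))
      \<and> mball (f i) (2 / real (Suc (n i))) \<subseteq> U i"
    by metis
  have "inj_on (\<lambda>i. (n i, x i)) I"
  proof (rule inj_onI, rule ccontr)
    fix i j assume ij: "i \<in> I" "j \<in> I" "(n i, x i) = (n j, x j)" "i \<noteq> j"
    let ?r = "1 / real (Suc (n i))"
    have i: "f i \<in> M" "x i \<in> M" "d (f i) (x i) < ?r" using nx[OF ij(1)] by auto
    have j: "f j \<in> M" "d (f j) (x i) < ?r" using nx[OF ij(2)] ij(3) by auto
    have "d (f i) (f j) < 2 / real (Suc (n i))"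
      using triangle'[of "f i" "x i" "f j"] i j by (simp add: commute)
    then have "f j \<in> U i" "f i \<in> U j"
      using nx[OF ij(1)] nx[OF ij(2)] i j ij(3) by (auto simp: commute)
    then show False using sep ij by blast
  qed
  moreover have "(\<lambda>i. (n i, x i)) ` I \<subseteq> UNIV \<times> D" using nx by auto
  ultimately show ?thesis
    using D by (meson countable_SIGMA countableI_type countable_image_inj_on countable_subset)
qed

section \<open>Values of rational functions\<close>

text \<open>Cross-multiplication shows that all representations whose denominators do not vanish at
  \<open>x\<close> yield the same quotient, so any one of them may be used for evaluation.\<close>

lemma ratfun_has_value_Fract:
  assumes "poly q x \<noteq> 0"
  shows "ratfun_has_value (Fract p q) x a \<longleftrightarrow> a = poly p x / poly q x"
proof
  assume "ratfun_has_value (Fract p q) x a"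
  then obtain p' q' where h: "Fract p q = Fract p' q'" "poly q' x \<noteq> 0" "a = poly p' x / poly q' x"
    unfolding ratfun_has_value_def by blast
  have "q \<noteq> 0" "q' \<noteq> 0" using assms h by auto
  then have "p * q' = p' * q" using h(1) by (simp add: eq_fract)
  then have "poly p x * poly q' x = poly p' x * poly q x" by (metis poly_mult)
  then show "a = poly p x / poly q x" using assms h(2,3) by (simp add: frac_eq_eq)
qed (use assms in \<open>auto simp: ratfun_has_value_def\<close>)

lemma ratfun_has_value_diff:
  assumes "ratfun_has_value \<phi> x a" "ratfun_has_value \<psi> x b"
  shows "ratfun_has_value (\<phi> - \<psi>) x (a - b)"
proof -
  obtain p q p' q' where h: "\<phi> = Fract p q" "poly q x \<noteq> 0" "a = poly p x / poly q x"
    "\<psi> = Fract p' q'" "poly q' x \<noteq> 0" "b = poly p' x / poly q' x"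
    using assms unfolding ratfun_has_value_def by blast
  have "q \<noteq> 0" "q' \<noteq> 0" using h by auto
  then have "\<phi> - \<psi> = Fract (p * q' - p' * q) (q * q')" using h by simp
  moreover have nz: "poly (q * q') x \<noteq> 0" using h by simp
  ultimately show ?thesis
    using h(2,3,5,6) by (simp add: ratfun_has_value_Fract[OF nz] diff_frac_eq)
qed

lemma ratfun_has_value_mult:
  assumes "ratfun_has_value \<phi> x a" "ratfun_has_value \<psi> x b"
  shows "ratfun_has_value (\<phi> * \<psi>) x (a * b)"
proof -
  obtain p q p' q' where h: "\<phi> = Fract p q" "poly q x \<noteq> 0" "a = poly p x / poly q x"
    "\<psi> = Fract p' q'" "poly q' x \<noteq> 0" "b = poly p' x / poly q' x"
    using assms unfolding ratfun_has_value_def by blast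
  then have "\<phi> * \<psi> = Fract (p * p') (q * q')" by simp
  then show ?thesis using h by (simp add: ratfun_has_value_Fract)
qed

section \<open>Valuation rings and the order of values\<close>

locale valued_field =
  fixes V :: "'a::field set"
  assumes V: "valuation_domain V"
begin

text \<open>\<open>vless x y\<close> says \<open>v x < v y\<close>, for nonzero y; it is false for \<open>y = 0\<close> and for \<open>x = 0\<close>.\<close>

definition vless :: "'a \<Rightarrow> 'a \<Rightarrow> bool" where
  "vless x y \<longleftrightarrow> x / y \<notin> V"

lemma one_mem [simp]: "1 \<in> V"
  and diff_mem: "x \<in> V \<Longrightarrow> y \<in> V \<Longrightarrow> x - y \<in> V"
  and mult_mem: "x \<in> V \<Longrightarrow> y \<in> V \<Longrightarrow> x * y \<in> V"
  and mem_or_inverse: "x \<noteq> 0 \<Longrightarrow> x \<in> V \<or> inverse x \<in> V"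
  using V unfolding valuation_domain_def by auto

lemma zero_mem [simp]: "0 \<in> V"
  using diff_mem[of 1 1] by simp

lemma minus_mem: "x \<in> V \<Longrightarrow> - x \<in> V"
  using diff_mem[of 0 x] by simp

lemma add_mem: "x \<in> V \<Longrightarrow> y \<in> V \<Longrightarrow> x + y \<in> V"
  using diff_mem[of x "- y"] minus_mem by simp

lemma power_mem: "x \<in> V \<Longrightarrow> x ^ n \<in> V"
  by (induction n) (auto intro: mult_mem)

text \<open>An instance of integral closedness: if \<open>y\<close> were not in \<open>V\<close>,
  then \<open>inverse y\<close> would be, and \<open>y\<close> is the product of
  \<open>y ^ k\<close> and \<open>inverse y ^ (k - 1)\<close>.\<close>

lemma root_mem:
  assumes "y ^ k \<in> V" "k > 0"
  shows "y \<in> V"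
proof (rule ccontr)
  assume y: "y \<notin> V"
  then have "y \<noteq> 0" "inverse y \<in> V" using mem_or_inverse zero_mem by metis+
  have "y = y ^ k * inverse y ^ (k - 1)"
    using assms(2) \<open>y \<noteq> 0\<close> by (cases k) (simp_all add: power_inverse)
  then show False using y mult_mem[OF assms(1) power_mem[OF \<open>inverse y \<in> V\<close>]] by metis
qed

lemma vless_nonzero: "vless x y \<Longrightarrow> x \<noteq> 0 \<and> y \<noteq> 0"
  unfolding vless_def by auto

lemma vless_mem: "vless x y \<Longrightarrow> y / x \<in> V"
  using mem_or_inverse[of "x / y"] vless_nonzero[of x y] unfolding vless_def
  by (auto simp: inverse_eq_divide)

lemma vless_trans:
  assumes "vless x y" "vless y z"
  shows "vless x z"
proof (rule ccontr)
  assume "\<not> vless x z"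
  then have "x / z * (z / y) \<in> V" using vless_mem[OF assms(2)] mult_mem unfolding vless_def by blast
  then show False using assms vless_nonzero unfolding vless_def by fastforce
qed

text \<open>Since \<open>x / 0 = 0\<close>, \<open>vless x 0\<close> is false although
  \<open>v 0\<close> is infinite; this is why \<open>z\<close> must be nonzero.\<close>

lemma vless_le_trans:
  assumes "vless x y" "\<not> vless z y" "z \<noteq> 0"
  shows "vless x z"
proof (rule ccontr)
  assume "\<not> vless x z"
  then have "x / z * (z / y) \<in> V" using assms(2) mult_mem unfolding vless_def by blast
  then show False using assms vless_nonzero unfolding vless_def by fastforce
qed

lemma le_vless_trans:
  assumes "\<not> vless y x" "vless y z" "x \<noteq> 0"
  shows "vless x z"
proof (rule ccontr)
  assume "\<not> vless x z"
  then have "y / x * (x / z) \<in> V" using assms(1) mult_mem unfolding vless_def by blast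
  then show False using assms vless_nonzero unfolding vless_def by fastforce
qed

lemma unit_group_one: "1 \<in> unit_group V"
  and unit_group_mult: "u \<in> unit_group V \<Longrightarrow> w \<in> unit_group V \<Longrightarrow> u * w \<in> unit_group V"
  and unit_group_inverse: "u \<in> unit_group V \<Longrightarrow> inverse u \<in> unit_group V"
  and unit_group_nonzero: "u \<in> unit_group V \<Longrightarrow> u \<noteq> 0"
  unfolding unit_group_def by (auto intro: mult_mem)

lemma unit_mult_mem_iff:
  assumes "u \<in> unit_group V"
  shows "u * x \<in> V \<longleftrightarrow> x \<in> V"
proof
  assume "u * x \<in> V"
  then have "inverse u * (u * x) \<in> V" using assms mult_mem unfolding unit_group_def by blast
  then show "x \<in> V" using unit_group_nonzero[OF assms] by (simp add: mult.assoc[symmetric])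
qed (use assms mult_mem in \<open>auto simp: unit_group_def\<close>)

text \<open>Here \<open>z\<close> lies in the maximal ideal. As \<open>1 / z\<close> is not in
  \<open>V\<close>, neither is \<open>(1 + z) / z\<close>, so its inverse is, and
  \<open>1 / (1 + z) = 1 - z / (1 + z)\<close>.\<close>

lemma one_plus_unit:
  assumes "vless 1 z \<or> z = 0"
  shows "1 + z \<in> unit_group V"
proof (cases "z = 0")
  case True then show ?thesis using unit_group_one by simp
next
  case False
  then have z: "inverse z \<notin> V" "z \<in> V" using assms vless_mem[of 1 z]
    by (auto simp: vless_def inverse_eq_divide)
  have nz: "1 + z \<noteq> 0"
  proof
    assume "1 + z = 0"
    then have "z = - 1" by (simp add: add_eq_0_iff)
    then show False using z minus_mem[of 1] by simp
  qed
  have "(1 + z) / z \<notin> V"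
  proof
    assume "(1 + z) / z \<in> V"
    then have "(1 + z) / z - 1 \<in> V" using diff_mem by simp
    then show False using z False by (simp add: field_simps)
  qed
  then have "z / (1 + z) \<in> V" using mem_or_inverse[of "(1 + z) / z"] nz False by auto
  then have "1 - z / (1 + z) \<in> V" using diff_mem by simp
  moreover have "1 - z / (1 + z) = inverse (1 + z)" using nz by (simp add: field_simps)
  ultimately show ?thesis unfolding unit_group_def using nz z add_mem by auto
qed

text \<open>Strict ultrametric inequality: the summand of smaller value dominates, the unit being
  \<open>1 + y / x\<close>.\<close>

lemma vless_add_unit:
  assumes "vless x y \<or> y = 0" "x \<noteq> 0"
  shows "\<exists>u\<in>unit_group V. x + y = u * x"
proof
  show "1 + y / x \<in> unit_group V"
    by (rule one_plus_unit) (use assms in \<open>auto simp: vless_def\<close>)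
qed (use assms in \<open>simp add: field_simps\<close>)

section \<open>Values as cosets of the unit group\<close>

lemma val_eq_iff:
  "val V x = val V y \<longleftrightarrow> (\<exists>u\<in>unit_group V. x = u * y)"
proof
  assume "val V x = val V y"
  moreover have "x \<in> val V x" unfolding val_def using unit_group_one by force
  ultimately show "\<exists>u\<in>unit_group V. x = u * y" unfolding val_def by auto
next
  assume "\<exists>u\<in>unit_group V. x = u * y"
  then obtain u where u: "u \<in> unit_group V" "x = u * y" by blast
  show "val V x = val V y"
  proof
    show "val V x \<subseteq> val V y" unfolding val_def using u unit_group_mult
      by (auto simp: mult.assoc[symmetric])
    show "val V y \<subseteq> val V x"
    proof
      fix z assume "z \<in> val V y"
      then obtain w where w: "w \<in> unit_group V" "z = w * y" unfolding val_def by auto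
      then have "z = (w * inverse u) * x" using u unit_group_nonzero by simp
      then show "z \<in> val V x" unfolding val_def using w u unit_group_mult unit_group_inverse by blast
    qed
  qed
qed

lemma val_le_iff:
  assumes "x \<noteq> 0"
  shows "val_le V (val V x) (val V y) \<longleftrightarrow> \<not> vless y x"
proof
  assume "val_le V (val V x) (val V y)"
  moreover have "y \<in> val V y" unfolding val_def using unit_group_one by force
  ultimately obtain u c where "u \<in> unit_group V" "c \<in> V" "y = c * (u * x)"
    unfolding val_le_def by (auto simp: val_def)
  then show "\<not> vless y x" unfolding vless_def unit_group_def using assms mult_mem by auto
next
  assume h: "\<not> vless y x"
  show "val_le V (val V x) (val V y)" unfolding val_le_def
  proof
    fix b assume "b \<in> val V y"
    then obtain w where w: "w \<in> unit_group V" "b = w * y" unfolding val_def by auto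
    have "x \<in> val V x" unfolding val_def using unit_group_one by force
    moreover have "w * (y / x) \<in> V" using h w unit_mult_mem_iff unfolding vless_def by blast
    moreover have "b = w * (y / x) * x" using w assms by simp
    ultimately show "\<exists>a\<in>val V x. \<exists>c\<in>V. b = c * a" by blast
  qed
qed

lemma val_less_iff:
  assumes "x \<noteq> 0" "y \<noteq> 0"
  shows "val_less V (val V x) (val V y) \<longleftrightarrow> vless x y"
proof -
  have "val V x = val V y \<longleftrightarrow> \<not> vless x y \<and> \<not> vless y x"
  proof
    assume "val V x = val V y"
    then obtain u where "u \<in> unit_group V" "x = u * y" using val_eq_iff by auto
    then show "\<not> vless x y \<and> \<not> vless y x"
      using assms unfolding vless_def unit_group_def by (auto simp: inverse_eq_divide)
  next
    assume "\<not> vless x y \<and> \<not> vless y x"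
    then have "x / y \<in> unit_group V" using assms unfolding vless_def unit_group_def by auto
    moreover have "x = x / y * y" using assms by simp
    ultimately show "val V x = val V y" using val_eq_iff by blast
  qed
  moreover have "vless x y \<Longrightarrow> \<not> vless y x" using vless_mem unfolding vless_def by blast
  ultimately show ?thesis unfolding val_less_def using val_le_iff[OF assms(1)] by blast
qed

lemma val_eqI:
  assumes "x \<noteq> 0" "y \<noteq> 0" "\<not> vless x y" "\<not> vless y x"
  shows "val V x = val V y"
  using assms val_le_iff[of x y] val_less_iff[of x y] unfolding val_less_def by blast

section \<open>Left neighbourhoods of a value\<close>

text \<open>The filter of punctured left neighbourhoods of \<open>v c\<close> in the value group,
  pulled back to field elements.\<close>

definition near :: "'a \<Rightarrow> ('a \<Rightarrow> bool) \<Rightarrow> bool" where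
  "near c P \<longleftrightarrow> (\<exists>t. vless t c \<and> (\<forall>x. vless t x \<longrightarrow> vless x c \<longrightarrow> P x))"

lemma near_mono:
  "near c P \<Longrightarrow> (\<And>x. vless x c \<Longrightarrow> P x \<Longrightarrow> Q x) \<Longrightarrow> near c Q"
  unfolding near_def by blast

lemma near_conj:
  assumes "near c P" "near c Q"
  shows "near c (\<lambda>x. P x \<and> Q x)"
proof -
  obtain t where t: "vless t c" "\<And>x. vless t x \<Longrightarrow> vless x c \<Longrightarrow> P x"
    using assms(1) unfolding near_def by blast
  obtain s where s: "vless s c" "\<And>x. vless s x \<Longrightarrow> vless x c \<Longrightarrow> Q x"
    using assms(2) unfolding near_def by blast
  show ?thesis
  proof (cases "vless t s")
    case True
    then show ?thesis unfolding near_def using s t vless_trans by blast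
  next
    case False
    then have "vless s x" if "vless t x" for x
      using le_vless_trans that vless_nonzero[OF s(1)] by blast
    then show ?thesis unfolding near_def using s t by blast
  qed
qed

end

section \<open>Rational functions to the left of a value\<close>

text \<open>One fixed null sequence serves twice: the quotients \<open>c / d n\<close> approach
  every value \<open>v c\<close> from below, and powers of the \<open>d n\<close> supply a countable
  order-dense set of values.\<close>

locale nondiscrete_valued_field = valued_field +
  fixes d :: "nat \<Rightarrow> 'a"
  assumes d_pos: "vless 1 (d n)"
    and d_decreasing: "vless (d (Suc n)) (d n)"
    and d_null: "vless 1 e \<Longrightarrow> \<exists>n. vless (d n) e"
begin

lemma d_nonzero [simp]: "d n \<noteq> 0"
  using vless_nonzero[OF d_pos] by simp

lemma d_mono: "n \<le> m \<Longrightarrow> \<not> vless (d n) (d m)"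
proof (induction m rule: dec_induct)
  case base
  show ?case by (simp add: vless_def)
next
  case (step m)
  show ?case using d_decreasing step.IH vless_trans by blast
qed

lemma near_True: "c \<noteq> 0 \<Longrightarrow> near c (\<lambda>x. True)"
  unfolding near_def using d_pos[of 0] by (intro exI[of _ "c / d 0"]) (simp add: vless_def)

text \<open>The value of \<open>a * x ^ k\<close> increases strictly with \<open>v x\<close>. Once
  it is nonnegative at some \<open>y\<close> below \<open>c\<close> it is positive beyond
  \<open>y\<close>; if there is no such \<open>y\<close> it is negative everywhere below
  \<open>c\<close>.\<close>

lemma monomial_near:
  assumes "k > 0" "a \<noteq> 0" "c \<noteq> 0"
  shows "near c (\<lambda>x. vless 1 (a * x ^ k)) \<or> near c (\<lambda>x. vless (a * x ^ k) 1)"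
proof (cases "\<exists>y. vless y c \<and> a * y ^ k \<in> V")
  case True
  then obtain y where y: "vless y c" "a * y ^ k \<in> V" by blast
  have "vless 1 (a * x ^ k)" if x: "vless y x" for x
  proof (rule ccontr)
    assume "\<not> vless 1 (a * x ^ k)"
    then have "a * y ^ k * (1 / (a * x ^ k)) \<in> V" using y mult_mem unfolding vless_def by blast
    moreover have "a * y ^ k * (1 / (a * x ^ k)) = (y / x) ^ k"
      using assms by (simp add: power_divide)
    ultimately show False using root_mem assms(1) x unfolding vless_def by metis
  qed
  then show ?thesis using y(1) unfolding near_def by blast
next
  case False
  have "near c (\<lambda>x. vless (a * x ^ k) 1)"
    by (rule near_mono[OF near_True[OF assms(3)]]) (use False in \<open>auto simp: vless_def[of _ 1]\<close>)
  then show ?thesis by blast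
qed

text \<open>Induction along the Horner scheme \<open>a + x * p(x)\<close>: where \<open>p(x)\<close>
  is a monomial up to a unit, one of the two summands strictly dominates near \<open>c\<close>, and
  the sum equals the dominating one up to a unit.\<close>

lemma poly_near:
  assumes c: "c \<noteq> 0"
  shows "p \<noteq> 0 \<Longrightarrow> \<exists>b i. b \<noteq> 0 \<and> near c (\<lambda>x. \<exists>u\<in>unit_group V. poly p x = u * (b * x ^ i))"
proof (induction p)
  case 0
  then show ?case by simp
next
  case (pCons a p)
  show ?case
  proof (cases "p = 0")
    case True
    then have "a \<noteq> 0" using pCons by simp
    moreover have "near c (\<lambda>x. \<exists>u\<in>unit_group V. poly (pCons a p) x = u * (a * x ^ 0))"
      by (rule near_mono[OF near_True[OF c]], rule bexI[OF _ unit_group_one]) (simp add: True)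
    ultimately show ?thesis by blast
  next
    case False
    then obtain b i where b: "b \<noteq> 0"
      and nr: "near c (\<lambda>x. \<exists>u\<in>unit_group V. poly p x = u * (b * x ^ i))"
      using pCons.IH by blast
    have *: "\<exists>u\<in>unit_group V. poly (pCons a p) x = u * (b * x ^ Suc i)"
      if h: "\<exists>u\<in>unit_group V. poly p x = u * (b * x ^ i)" "vless (b * x ^ Suc i) a \<or> a = 0" "x \<noteq> 0" for x
    proof -
      obtain u where u: "u \<in> unit_group V" "poly p x = u * (b * x ^ i)" using h by blast
      have "vless (u * (b * x ^ Suc i)) a \<or> a = 0"
        using h(2) unit_mult_mem_iff[OF u(1), of "b * x ^ Suc i / a"]
        unfolding vless_def times_divide_eq_right by blast
      then obtain w where w: "w \<in> unit_group V"
          "u * (b * x ^ Suc i) + a = w * (u * (b * x ^ Suc i))"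
        using vless_add_unit[of "u * (b * x ^ Suc i)" a] unit_group_nonzero[OF u(1)] b h(3)
        by (metis mult_eq_0_iff power_not_zero)
      then have "poly (pCons a p) x = (w * u) * (b * x ^ Suc i)"
        using u by (simp add: algebra_simps)
      then show ?thesis using w u unit_group_mult by blast
    qed
    show ?thesis
    proof (cases "a = 0")
      case True
      have "near c (\<lambda>x. \<exists>u\<in>unit_group V. poly (pCons a p) x = u * (b * x ^ Suc i))"
      proof (rule near_mono[OF nr], rule *)
        fix x assume "vless x c"
        then show "x \<noteq> 0" using vless_nonzero by blast
      qed (use True in auto)
      then show ?thesis using b by blast
    next
      case a: False
      \<comment> \<open>The quotient of the two summands is a monomial of positive degree, so their
        values differ near \<open>c\<close>.\<close>
      have "near c (\<lambda>x. vless 1 (b / a * x ^ Suc i)) \<or> near c (\<lambda>x. vless (b / a * x ^ Suc i) 1)"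
        by (rule monomial_near) (use a b c in simp_all)
      then show ?thesis
      proof
        assume n1: "near c (\<lambda>x. vless 1 (b / a * x ^ Suc i))"
        have "near c (\<lambda>x. \<exists>u\<in>unit_group V. poly (pCons a p) x = u * (a * x ^ 0))"
        proof (rule near_mono[OF near_conj[OF n1 nr]])
          fix x assume h: "vless 1 (b / a * x ^ Suc i) \<and> (\<exists>u\<in>unit_group V. poly p x = u * (b * x ^ i))"
          then obtain u where u: "u \<in> unit_group V" "poly p x = u * (b * x ^ i)" by blast
          have eq: "a / (x * poly p x) = inverse u * (1 / (b / a * x ^ Suc i))"
            unfolding u(2) by (simp add: field_simps)
          have "vless a (x * poly p x)"
            unfolding vless_def eq unit_mult_mem_iff[OF unit_group_inverse[OF u(1)]]
            using h unfolding vless_def by blast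
          then show "\<exists>u\<in>unit_group V. poly (pCons a p) x = u * (a * x ^ 0)"
            using vless_add_unit[of a "x * poly p x"] a by simp
        qed
        then show ?thesis using a by blast
      next
        assume n1: "near c (\<lambda>x. vless (b / a * x ^ Suc i) 1)"
        have "near c (\<lambda>x. \<exists>u\<in>unit_group V. poly (pCons a p) x = u * (b * x ^ Suc i))"
        proof (rule near_mono[OF near_conj[OF n1 nr]], rule *)
          fix x assume x: "vless x c" and
            h: "vless (b / a * x ^ Suc i) 1 \<and> (\<exists>u\<in>unit_group V. poly p x = u * (b * x ^ i))"
          show "x \<noteq> 0" using vless_nonzero[OF x] by simp
          show "vless (b * x ^ Suc i) a \<or> a = 0" using h by (simp add: vless_def)
          show "\<exists>u\<in>unit_group V. poly p x = u * (b * x ^ i)" using h by blast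
        qed
        then show ?thesis using b by blast
      qed
    qed
  qed
qed

text \<open>For \<open>i = j\<close> the expression is constant; otherwise it or its reciprocal is a
  monomial of positive degree, whose value has a constant nonzero sign near
  \<open>c\<close>.\<close>

lemma laurent_monomial_near:
  assumes "a \<noteq> 0" "c \<noteq> 0"
  shows "near c (\<lambda>x. a * x ^ i / x ^ j \<in> V) \<or> near c (\<lambda>x. a * x ^ i / x ^ j \<notin> V)"
proof -
  consider "i = j" | "j < i" | "i < j" by linarith
  then show ?thesis
  proof cases
    case 1
    have *: "a * x ^ i / x ^ j = a" if "vless x c" for x
      using vless_nonzero[OF that] 1 by simp
    show ?thesis
    proof (cases "a \<in> V")
      case True
      then show ?thesis using near_mono[OF near_True[OF assms(2)]] * by auto
    next
      case False
      have "near c (\<lambda>x. a * x ^ i / x ^ j \<notin> V)"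
        by (rule near_mono[OF near_True[OF assms(2)]]) (use * False in auto)
      then show ?thesis by blast
    qed
  next
    case 2
    have *: "a * x ^ i / x ^ j = a * x ^ (i - j)" if "vless x c" for x
      using vless_nonzero[OF that] 2 by (simp add: power_diff)
    have "near c (\<lambda>x. vless 1 (a * x ^ (i - j))) \<or> near c (\<lambda>x. vless (a * x ^ (i - j)) 1)"
      using 2 assms by (intro monomial_near) auto
    then show ?thesis
    proof (elim disjE)
      assume "near c (\<lambda>x. vless 1 (a * x ^ (i - j)))"
      then have "near c (\<lambda>x. a * x ^ i / x ^ j \<in> V)"
        by (rule near_mono) (drule vless_mem, simp add: *)
      then show ?thesis by blast
    next
      assume "near c (\<lambda>x. vless (a * x ^ (i - j)) 1)"
      then have "near c (\<lambda>x. a * x ^ i / x ^ j \<notin> V)"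
        by (rule near_mono) (simp add: * vless_def[of "_ * _"] vless_def[of 1])
      then show ?thesis by blast
    qed
  next
    case 3
    have *: "a * x ^ i / x ^ j = 1 / (inverse a * x ^ (j - i))" if "vless x c" for x
      using vless_nonzero[OF that] 3 by (simp add: power_diff field_simps)
    have "near c (\<lambda>x. vless 1 (inverse a * x ^ (j - i))) \<or> near c (\<lambda>x. vless (inverse a * x ^ (j - i)) 1)"
      using 3 assms by (intro monomial_near) auto
    then show ?thesis
    proof (elim disjE)
      assume "near c (\<lambda>x. vless 1 (inverse a * x ^ (j - i)))"
      then have "near c (\<lambda>x. a * x ^ i / x ^ j \<notin> V)"
        by (rule near_mono) (simp add: * vless_def[of "_ * _"] vless_def[of 1])
      then show ?thesis by blast
    next
      assume "near c (\<lambda>x. vless (inverse a * x ^ (j - i)) 1)"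
      then have "near c (\<lambda>x. a * x ^ i / x ^ j \<in> V)"
        by (rule near_mono) (drule vless_mem, simp add: *)
      then show ?thesis by blast
    qed
  qed
qed

definition ratfun_integral :: "'a poly fract \<Rightarrow> 'a \<Rightarrow> bool" where
  "ratfun_integral \<phi> x \<longleftrightarrow> (\<exists>a\<in>V. ratfun_has_value \<phi> x a)"

text \<open>Near \<open>c\<close> numerator and denominator are nonzero monomials up to units, so
  integrality is that of a Laurent monomial. The second alternative also records the inverse, which
  later makes the limit rings valuation domains.\<close>

lemma ratfun_near:
  assumes c: "c \<noteq> 0" and "\<phi> \<noteq> 0"
  shows "near c (ratfun_integral \<phi>) \<or>
    near c (\<lambda>x. \<not> ratfun_integral \<phi> x \<and> ratfun_integral (inverse \<phi>) x)"
proof -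
  obtain p q where pq: "\<phi> = Fract p q" "q \<noteq> 0" using Fract_cases by blast
  then have p: "p \<noteq> 0" using \<open>\<phi> \<noteq> 0\<close> fract_collapse by auto
  obtain b i where b: "b \<noteq> 0" and nb: "near c (\<lambda>x. \<exists>u\<in>unit_group V. poly p x = u * (b * x ^ i))"
    using poly_near[OF c p] by blast
  obtain b' j where b': "b' \<noteq> 0" and nb': "near c (\<lambda>x. \<exists>u\<in>unit_group V. poly q x = u * (b' * x ^ j))"
    using poly_near[OF c pq(2)] by blast
  let ?P = "\<lambda>x. poly p x \<noteq> 0 \<and> poly q x \<noteq> 0 \<and>
    (poly p x / poly q x \<in> V \<longleftrightarrow> b / b' * x ^ i / x ^ j \<in> V)"
  have P: "near c ?P"
  proof (rule near_mono[OF near_conj[OF nb nb']])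
    fix x assume x: "vless x c" "(\<exists>u\<in>unit_group V. poly p x = u * (b * x ^ i)) \<and>
      (\<exists>u\<in>unit_group V. poly q x = u * (b' * x ^ j))"
    then obtain u w where u: "u \<in> unit_group V" "poly p x = u * (b * x ^ i)"
      and w: "w \<in> unit_group V" "poly q x = w * (b' * x ^ j)" by blast
    have nz: "u \<noteq> 0" "w \<noteq> 0" "x \<noteq> 0"
      using u w x unit_group_nonzero vless_nonzero by blast+
    have "poly p x / poly q x = (u * inverse w) * (b / b' * x ^ i / x ^ j)"
      using u w by (simp add: field_simps)
    then have "poly p x / poly q x \<in> V \<longleftrightarrow> b / b' * x ^ i / x ^ j \<in> V"
      using unit_mult_mem_iff[OF unit_group_mult[OF u(1) unit_group_inverse[OF w(1)]]] by metis
    then show "?P x" using u w nz b b' by simp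
  qed
  have val: "ratfun_integral \<phi> x \<longleftrightarrow> poly p x / poly q x \<in> V" if "poly q x \<noteq> 0" for x
    using that pq by (simp add: ratfun_integral_def ratfun_has_value_Fract)
  have val': "ratfun_integral (inverse \<phi>) x \<longleftrightarrow> poly q x / poly p x \<in> V" if "poly p x \<noteq> 0" for x
    using that pq by (simp add: ratfun_integral_def ratfun_has_value_Fract)
  have "near c (\<lambda>x. b / b' * x ^ i / x ^ j \<in> V) \<or> near c (\<lambda>x. b / b' * x ^ i / x ^ j \<notin> V)"
    by (rule laurent_monomial_near) (use b b' c in simp_all)
  then show ?thesis
  proof
    assume "near c (\<lambda>x. b / b' * x ^ i / x ^ j \<in> V)"
    then have "near c (ratfun_integral \<phi>)"
      using near_mono[OF near_conj[OF P]] val by auto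
    then show ?thesis by blast
  next
    assume n: "near c (\<lambda>x. b / b' * x ^ i / x ^ j \<notin> V)"
    have "near c (\<lambda>x. \<not> ratfun_integral \<phi> x \<and> ratfun_integral (inverse \<phi>) x)"
    proof (rule near_mono[OF near_conj[OF P n]])
      fix x assume "?P x \<and> b / b' * x ^ i / x ^ j \<notin> V"
      then show "\<not> ratfun_integral \<phi> x \<and> ratfun_integral (inverse \<phi>) x"
        using val val' mem_or_inverse[of "poly p x / poly q x"] by auto
    qed
    then show ?thesis by blast
  qed
qed

section \<open>The domains \<open>W\<^sub>c\<close>\<close>

definition cut_domain :: "'a \<Rightarrow> 'a poly fract set" where
  "cut_domain c = pc_domain V (\<lambda>n. c / d n)"

lemma mem_cut_domain:
  "\<phi> \<in> cut_domain c \<longleftrightarrow> (\<forall>\<^sub>F n in sequentially. ratfun_integral \<phi> (c / d n))"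
  unfolding cut_domain_def pc_domain_def ratfun_integral_def
  by (simp add: cofinite_eq_sequentially)

lemma eventually_d_vless:
  assumes "vless 1 e"
  shows "\<forall>\<^sub>F n in sequentially. vless (d n) e"
proof -
  obtain N where "vless (d N) e" using d_null[OF assms] by blast
  then have "vless (d n) e" if "n \<ge> N" for n
    using le_vless_trans[OF d_mono[OF that]] by simp
  then show ?thesis unfolding eventually_sequentially by blast
qed

text \<open>\<open>v (c / d n) = v c - v (d n)\<close> exceeds \<open>v t\<close> as soon as
  \<open>v (d n) < v (c / t)\<close>, and it is always below \<open>v c\<close>.\<close>

lemma near_eventually:
  assumes "near c P"
  shows "\<forall>\<^sub>F n in sequentially. P (c / d n)"
proof -
  obtain t where t: "vless t c" "\<And>x. vless t x \<Longrightarrow> vless x c \<Longrightarrow> P x"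
    using assms unfolding near_def by blast
  have "vless 1 (c / t)" using t(1) by (simp add: vless_def)
  from eventually_d_vless[OF this] show ?thesis
  proof eventually_elim
    case (elim n)
    then have "vless t (c / d n)" by (simp add: vless_def mult.commute)
    moreover have "vless (c / d n) c" using d_pos[of n] vless_nonzero[OF t(1)] by (simp add: vless_def)
    ultimately show ?case using t by blast
  qed
qed

text \<open>The same \<open>t\<close> works for every \<open>c'\<close> with
  \<open>v t < v c' \<le> v c\<close>; this is where the half-open intervals come from.\<close>

lemma near_below:
  assumes "\<forall>x. vless t x \<longrightarrow> vless x c \<longrightarrow> P x" "vless t c'" "\<not> vless c c'" "c \<noteq> 0"
  shows "near c' P"
  unfolding near_def
proof (intro exI[of _ t] conjI allI impI)
  fix x assume x: "vless t x" "vless x c'"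
  then have "vless x c" using vless_le_trans[OF x(2) assms(3,4)] by blast
  then show "P x" using assms(1) x(1) by blast
qed (rule assms(2))

text \<open>Membership of \<open>\<phi>\<close> in \<open>cut_domain c'\<close> is constant for \<open>v c'\<close> in a half-open interval
  ending at \<open>v c\<close>: the induced topologies are coarser than a Sorgenfrey topology.\<close>

lemma cut_domain_left_constant:
  assumes c: "c \<noteq> 0"
  shows "\<exists>t. vless t c \<and> (\<forall>c'. vless t c' \<longrightarrow> \<not> vless c c' \<longrightarrow> (\<phi> \<in> cut_domain c' \<longleftrightarrow> \<phi> \<in> cut_domain c))"
proof -
  have "near c (ratfun_integral \<phi>) \<or> near c (\<lambda>x. \<not> ratfun_integral \<phi> x)"
  proof (cases "\<phi> = 0")
    case True
    have "ratfun_integral 0 x" for x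
      unfolding ratfun_integral_def using ratfun_has_value_Fract[of 1 x 0 0]
      by (intro bexI[of _ 0]) (simp_all add: Zero_fract_def)
    then have "near c (ratfun_integral \<phi>)" using True by (intro near_mono[OF near_True[OF c]]) simp
    then show ?thesis ..
  next
    case False
    show ?thesis
      using ratfun_near[OF c False] by (rule disj_forward) (auto elim: near_mono)
  qed
  then show ?thesis
  proof
    assume "near c (ratfun_integral \<phi>)"
    then obtain t where t: "vless t c" "\<forall>x. vless t x \<longrightarrow> vless x c \<longrightarrow> ratfun_integral \<phi> x"
      unfolding near_def by blast
    have "\<phi> \<in> cut_domain c'" if "vless t c'" "\<not> vless c c'" for c'
      unfolding mem_cut_domain by (rule near_eventually[OF near_below[OF t(2) that c]])
    moreover have "\<not> vless c c" using c by (simp add: vless_def)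
    ultimately show ?thesis using t(1) by blast
  next
    assume "near c (\<lambda>x. \<not> ratfun_integral \<phi> x)"
    then obtain t where t: "vless t c" "\<forall>x. vless t x \<longrightarrow> vless x c \<longrightarrow> \<not> ratfun_integral \<phi> x"
      unfolding near_def by blast
    have "\<phi> \<notin> cut_domain c'" if "vless t c'" "\<not> vless c c'" for c'
    proof
      assume "\<phi> \<in> cut_domain c'"
      then have "\<forall>\<^sub>F n in sequentially. ratfun_integral \<phi> (c' / d n) \<and> \<not> ratfun_integral \<phi> (c' / d n)"
        unfolding mem_cut_domain using near_eventually[OF near_below[OF t(2) that c]]
        by (rule eventually_conj)
      then show False by simp
    qed
    moreover have "\<not> vless c c" using c by (simp add: vless_def)
    ultimately show ?thesis using t(1) by blast
  qed
qed

text \<open>Differences and products are inherited from evaluation at the points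
  \<open>c / d n\<close>; that \<open>\<phi>\<close> or \<open>inverse \<phi>\<close> belongs to the
  ring is the dichotomy of \<open>ratfun_near\<close>.\<close>

lemma cut_domain_in_Zar:
  assumes c: "c \<noteq> 0"
  shows "cut_domain c \<in> Zar V"
proof -
  have const: "ratfun_const a \<in> cut_domain c" if "a \<in> V" for a
    unfolding mem_cut_domain ratfun_integral_def ratfun_const_def
    using that by (simp add: ratfun_has_value_Fract)
  have "ratfun_const 1 = (1 :: 'a poly fract)"
    unfolding ratfun_const_def by (simp add: One_fract_def one_pCons)
  then have one: "1 \<in> cut_domain c" using const[of 1] by simp
  have "\<phi> - \<psi> \<in> cut_domain c \<and> \<phi> * \<psi> \<in> cut_domain c"
    if "\<phi> \<in> cut_domain c" "\<psi> \<in> cut_domain c" for \<phi> \<psi>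
  proof -
    have *: "\<forall>\<^sub>F n in sequentially. ratfun_integral \<phi> (c / d n) \<and> ratfun_integral \<psi> (c / d n)"
      using that unfolding mem_cut_domain by (rule eventually_conj)
    show ?thesis unfolding mem_cut_domain
    proof
      show "\<forall>\<^sub>F n in sequentially. ratfun_integral (\<phi> - \<psi>) (c / d n)"
        using * by eventually_elim (meson ratfun_integral_def ratfun_has_value_diff diff_mem)
      show "\<forall>\<^sub>F n in sequentially. ratfun_integral (\<phi> * \<psi>) (c / d n)"
        using * by eventually_elim (meson ratfun_integral_def ratfun_has_value_mult mult_mem)
    qed
  qed
  moreover have "\<phi> \<in> cut_domain c \<or> inverse \<phi> \<in> cut_domain c" if "\<phi> \<noteq> 0" for \<phi>
    using ratfun_near[OF c that] unfolding mem_cut_domain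
    by (rule disj_forward) (auto intro!: near_eventually elim: near_mono)
  ultimately have "valuation_domain (cut_domain c)" unfolding valuation_domain_def using one by blast
  then show ?thesis unfolding Zar_def using const by blast
qed

text \<open>The values of \<open>c / d n\<close> increase strictly, so the difference of consecutive
  terms has the value of the earlier term, and these differences again have increasing
  values.\<close>

lemma cut_domain_in_pc_domains:
  assumes c: "c \<noteq> 0"
  shows "cut_domain c \<in> pc_domains V"
proof -
  have less: "vless (c / d n) (c / d (Suc n))" for n
    using d_decreasing[of n] c by (simp add: vless_def)
  have "\<exists>u\<in>unit_group V. c / d (Suc n) - c / d n = u * (c / d n)" for n
  proof -
    have "vless (- (c / d n)) (c / d (Suc n))"
      using less[of n] minus_mem[of "- (c / d n) / (c / d (Suc n))"] by (auto simp: vless_def)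
    then obtain u where u: "u \<in> unit_group V" "- (c / d n) + c / d (Suc n) = u * (- (c / d n))"
      using vless_add_unit c by (metis vless_nonzero)
    then have "- u \<in> unit_group V" unfolding unit_group_def using minus_mem
      by (auto simp: inverse_minus_eq)
    moreover have "c / d (Suc n) - c / d n = - u * (c / d n)" using u(2) by simp
    ultimately show ?thesis by blast
  qed
  then have "val V (c / d (Suc n) - c / d n) = val V (c / d n)" for n
    using val_eq_iff by blast
  then have "pseudo_convergent V (\<lambda>n. c / d n)"
    unfolding pseudo_convergent_def using less c by (simp add: val_less_iff)
  then show ?thesis unfolding pc_domains_def cut_domain_def by blast
qed

definition const_over_X :: "'a \<Rightarrow> 'a poly fract" where
  "const_over_X c = Fract [:c:] [:0, 1:]"

text \<open>At \<open>c' / d n\<close> the function has value \<open>v (c / c') + v (d n)\<close>.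
  As \<open>v (d n)\<close> is positive and tends to 0, this is eventually nonnegative exactly if
  \<open>v (c / c') \<ge> 0\<close>.\<close>

lemma const_over_X_mem_cut_domain:
  assumes "c \<noteq> 0" "c' \<noteq> 0"
  shows "const_over_X c \<in> cut_domain c' \<longleftrightarrow> \<not> vless c c'"
proof -
  have eq: "ratfun_integral (const_over_X c) (c' / d n) \<longleftrightarrow> c / (c' / d n) \<in> V" for n
    unfolding const_over_X_def ratfun_integral_def using assms by (simp add: ratfun_has_value_Fract)
  show ?thesis
  proof
    assume h: "const_over_X c \<in> cut_domain c'"
    show "\<not> vless c c'"
    proof
      assume l: "vless c c'"
      then have "vless 1 (c' / c)" by (simp add: vless_def)
      from eventually_d_vless[OF this] h[unfolded mem_cut_domain eq]
      have "\<forall>\<^sub>F n in sequentially. False"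
        by eventually_elim (simp add: vless_def mult.commute)
      then show False by simp
    qed
  next
    assume l: "\<not> vless c c'"
    have "c / c' * d n \<in> V" for n
      using mult_mem[of "c / c'" "d n / 1"] vless_mem[OF d_pos[of n]] l by (simp add: vless_def)
    then show "const_over_X c \<in> cut_domain c'" unfolding mem_cut_domain eq by simp
  qed
qed

section \<open>Half-open intervals and the two topologies\<close>

text \<open>The preimage of \<open>U\<close> under \<open>cut_domain\<close> is open in a Sorgenfrey
  topology, with the intervals \<open>(v t, v c]\<close> as basic neighbourhoods of
  \<open>v c\<close>.\<close>

definition left_open :: "'a poly fract set set \<Rightarrow> bool" where
  "left_open U \<longleftrightarrow> (\<forall>c. c \<noteq> 0 \<longrightarrow> cut_domain c \<in> U \<longrightarrow>
     (\<exists>t. vless t c \<and> (\<forall>c'. vless t c' \<longrightarrow> \<not> vless c c' \<longrightarrow> cut_domain c' \<in> U)))"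

lemma left_open_Int:
  assumes "left_open A" "left_open B"
  shows "left_open (A \<inter> B)"
  unfolding left_open_def
proof (intro allI impI)
  fix c :: 'a assume c: "c \<noteq> 0" "cut_domain c \<in> A \<inter> B"
  obtain t where t: "vless t c" "\<And>c'. vless t c' \<Longrightarrow> \<not> vless c c' \<Longrightarrow> cut_domain c' \<in> A"
    using assms(1) c unfolding left_open_def by blast
  obtain s where s: "vless s c" "\<And>c'. vless s c' \<Longrightarrow> \<not> vless c c' \<Longrightarrow> cut_domain c' \<in> B"
    using assms(2) c unfolding left_open_def by blast
  show "\<exists>t. vless t c \<and> (\<forall>c'. vless t c' \<longrightarrow> \<not> vless c c' \<longrightarrow> cut_domain c' \<in> A \<inter> B)"
  proof (cases "vless t s")
    case True
    then show ?thesis using s t vless_trans by blast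
  next
    case False
    then have "vless s x" if "vless t x" for x
      using le_vless_trans that vless_nonzero[OF s(1)] by blast
    then show ?thesis using s t by blast
  qed
qed

lemma left_open_Union:
  assumes "\<And>A. A \<in> \<A> \<Longrightarrow> left_open A"
  shows "left_open (\<Union>\<A>)"
  unfolding left_open_def
proof (intro allI impI)
  fix c :: 'a assume c: "c \<noteq> 0" "cut_domain c \<in> \<Union>\<A>"
  then obtain A where A: "A \<in> \<A>" "cut_domain c \<in> A" by blast
  then obtain t where "vless t c" "\<forall>c'. vless t c' \<longrightarrow> \<not> vless c c' \<longrightarrow> cut_domain c' \<in> A"
    using assms[OF A(1)] c(1) unfolding left_open_def by blast
  then show "\<exists>t. vless t c \<and> (\<forall>c'. vless t c' \<longrightarrow> \<not> vless c c' \<longrightarrow> cut_domain c' \<in> \<Union>\<A>)"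
    using A(1) by blast
qed

text \<open>Membership of \<open>\<phi>\<close> is constant on the interval, so the complement is
  covered as well; the constructible topology needs this.\<close>

lemma left_open_Zar_B: "left_open (Zar_B V \<phi>)"
  and left_open_Compl_Zar_B: "left_open (Zar V - Zar_B V \<phi>)"
proof -
  have "\<exists>t. vless t c \<and> (\<forall>c'. vless t c' \<longrightarrow> \<not> vless c c' \<longrightarrow>
      cut_domain c' \<in> Zar V \<and> (\<phi> \<in> cut_domain c' \<longleftrightarrow> \<phi> \<in> cut_domain c))" if c: "c \<noteq> 0" for c
  proof -
    obtain t where t: "vless t c"
      "\<And>c'. vless t c' \<Longrightarrow> \<not> vless c c' \<Longrightarrow> \<phi> \<in> cut_domain c' \<longleftrightarrow> \<phi> \<in> cut_domain c"
      using cut_domain_left_constant[OF c] by blast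
    moreover have "cut_domain c' \<in> Zar V" if "vless t c'" for c'
      using cut_domain_in_Zar vless_nonzero[OF that] by blast
    ultimately show ?thesis by blast
  qed
  then show "left_open (Zar_B V \<phi>)" "left_open (Zar V - Zar_B V \<phi>)"
    unfolding left_open_def Zar_B_def by fastforce+
qed

text \<open>Left-open sets are closed under binary intersections and arbitrary unions, so a subbase
  suffices.\<close>

lemma left_open_generate:
  assumes "generate_topology_on \<S> U" "\<And>A. A \<in> \<S> \<Longrightarrow> left_open A"
  shows "left_open U"
  using assms
proof (induction rule: generate_topology_on.induct)
  case Empty
  then show ?case by (simp add: left_open_def)
qed (auto intro: left_open_Int left_open_Union)

lemma left_open_zariski: "openin (zariski_topology V) U \<Longrightarrow> left_open U"
  unfolding zariski_topology_def openin_topology_generated_by_iff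
  by (erule left_open_generate) (auto intro: left_open_Zar_B)

lemma left_open_constructible:
  assumes "openin (constructible_topology V) U"
  shows "left_open U"
proof (rule left_open_generate)
  show "generate_topology_on
    (\<Union>F\<in>{F. finite F \<and> F \<noteq> {}}. {\<Inter>\<phi>\<in>F. Zar_B V \<phi>, Zar V - (\<Inter>\<phi>\<in>F. Zar_B V \<phi>)}) U"
    using assms unfolding constructible_topology_def openin_topology_generated_by_iff .
next
  fix A assume "A \<in> (\<Union>F\<in>{F. finite F \<and> F \<noteq> {}}. {\<Inter>\<phi>\<in>F. Zar_B V \<phi>, Zar V - (\<Inter>\<phi>\<in>F. Zar_B V \<phi>)})"
  then obtain F where F: "finite F" "F \<noteq> {}"
    and A: "A = (\<Inter>\<phi>\<in>F. Zar_B V \<phi>) \<or> A = Zar V - (\<Inter>\<phi>\<in>F. Zar_B V \<phi>)" by blast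
  have "left_open (\<Inter>\<phi>\<in>F. Zar_B V \<phi>)"
    using F by (induction rule: finite_ne_induct) (auto intro: left_open_Int left_open_Zar_B)
  \<comment> \<open>De Morgan reduces the complement of a finite intersection to complements of
    single sets \<open>Zar_B V \<phi>\<close>.\<close>
  moreover have "Zar V - (\<Inter>\<phi>\<in>F. Zar_B V \<phi>) = \<Union>((\<lambda>\<phi>. Zar V - Zar_B V \<phi>) ` F)" by blast
  then have "left_open (Zar V - (\<Inter>\<phi>\<in>F. Zar_B V \<phi>))"
    using left_open_Union[of "(\<lambda>\<phi>. Zar V - Zar_B V \<phi>) ` F"] left_open_Compl_Zar_B by auto
  ultimately show "left_open A" using A by blast
qed

section \<open>From metrizability to countably many values\<close>

text \<open>Stated for any \<open>T\<close> in which each \<open>Zar_B V \<phi>\<close> is open and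
  all open sets are left-open, to serve both topologies. The domains of elements of \<open>C\<close>
  are dense among all \<open>W\<^sub>c\<close>. Among these, \<open>const_over_X i\<close> cuts out
  the \<open>W\<^sub>j\<close> with \<open>v j \<le> v i\<close>, so for distinct values at least
  one neighbourhood misses the other point.\<close>

lemma metrizable_imp_countable_values:
  assumes T: "metrizable_space (subtopology T S)"
    and S: "\<And>c. c \<noteq> 0 \<Longrightarrow> cut_domain c \<in> S"
    and lopen: "\<And>U. openin T U \<Longrightarrow> left_open U"
    and Zopen: "\<And>\<phi>. openin T (Zar_B V \<phi>)"
    and C: "countable C" "\<And>t c. vless t c \<Longrightarrow> \<exists>c'\<in>C. vless t c' \<and> \<not> vless c c'"
  shows "countable (val V ` (- {0}))"
proof -
  let ?S = "cut_domain ` (- {0})"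
  let ?rep = "inv_into (- {0}) (val V)"
  \<comment> \<open>One representative per value: for distinct elements of equal value each domain
    lies in the other's neighbourhood, and the separation fails.\<close>
  let ?I = "?rep ` (val V ` (- {0}))"
  have I0: "i \<noteq> 0" if "i \<in> ?I" for i
    using that inv_into_into[of _ "val V" "- {0}"] by auto
  have met: "metrizable_space (subtopology T ?S)"
  proof -
    have "S \<inter> ?S = ?S" using S by auto
    then show ?thesis
      using metrizable_space_subtopology[OF T, of ?S] by (simp add: subtopology_subtopology)
  qed
  have "countable ?I"
  proof (rule metrizable_countable_left_separated[OF met, of "cut_domain ` C" ?I
        "\<lambda>i. Zar_B V (const_over_X i) \<inter> ?S" cut_domain])
    show "countable (cut_domain ` C)" using C(1) by simp
  next
    fix U assume "openin (subtopology T ?S) U" "U \<noteq> {}"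
    then obtain A where A: "openin T A" "U = A \<inter> ?S" unfolding openin_subtopology by blast
    then obtain c where c: "c \<noteq> 0" "cut_domain c \<in> A" using \<open>U \<noteq> {}\<close> by auto
    then obtain t where t: "vless t c" "\<And>c'. vless t c' \<Longrightarrow> \<not> vless c c' \<Longrightarrow> cut_domain c' \<in> A"
      using lopen[OF A(1)] unfolding left_open_def by blast
    then obtain c' where c': "c' \<in> C" "vless t c'" "\<not> vless c c'" using C(2) by blast
    then show "U \<inter> cut_domain ` C \<noteq> {}" using t(2)[of c'] A(2) vless_nonzero[of t c'] by auto
  next
    fix i assume i: "i \<in> ?I"
    have "openin (subtopology T ?S) (Zar_B V (const_over_X i) \<inter> ?S)"
      using Zopen openin_subtopology by blast
    moreover have "\<not> vless i i" using I0[OF i] by (simp add: vless_def)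
    then have "const_over_X i \<in> cut_domain i" using const_over_X_mem_cut_domain I0[OF i] by blast
    ultimately show "openin (subtopology T ?S) (Zar_B V (const_over_X i) \<inter> ?S) \<and>
        cut_domain i \<in> Zar_B V (const_over_X i) \<inter> ?S"
      unfolding Zar_B_def using cut_domain_in_Zar I0[OF i] by auto
  next
    fix i j assume ij: "i \<in> ?I" "j \<in> ?I" "i \<noteq> j"
    have nz: "i \<noteq> 0" "j \<noteq> 0" using I0[OF ij(1)] I0[OF ij(2)] .
    obtain \<alpha> where \<alpha>: "\<alpha> \<in> val V ` (- {0})" "i = ?rep \<alpha>" using ij(1) by blast
    obtain \<beta> where \<beta>: "\<beta> \<in> val V ` (- {0})" "j = ?rep \<beta>" using ij(2) by blast
    have "val V i = \<alpha>" "val V j = \<beta>"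
      unfolding \<alpha>(2) \<beta>(2) by (rule f_inv_into_f[OF \<alpha>(1)], rule f_inv_into_f[OF \<beta>(1)])
    moreover have "\<alpha> \<noteq> \<beta>" using \<alpha>(2) \<beta>(2) ij(3) by metis
    ultimately have "val V i \<noteq> val V j" by metis
    then have "vless i j \<or> vless j i"
      using val_eqI nz by blast
    then show "cut_domain j \<notin> Zar_B V (const_over_X i) \<inter> ?S \<or>
        cut_domain i \<notin> Zar_B V (const_over_X j) \<inter> ?S"
      using const_over_X_mem_cut_domain[OF nz] const_over_X_mem_cut_domain[OF nz(2,1)]
      unfolding Zar_B_def by blast
  qed
  then show ?thesis
    by (rule countable_image_inj_on) (rule inj_on_inv_into, rule subset_refl)
qed

end

section \<open>The value group in rank one\<close>

context valued_field
begin

lemma comm_group_field_mult: "comm_group (field_mult_group :: 'a monoid)"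
proof (rule comm_groupI)
  fix x :: 'a assume "x \<in> carrier field_mult_group"
  then show "\<exists>y\<in>carrier field_mult_group. y \<otimes>\<^bsub>field_mult_group\<^esub> x = \<one>\<^bsub>field_mult_group\<^esub>"
    by (intro bexI[of _ "inverse x"]) (auto simp: field_mult_group_def)
qed (auto simp: field_mult_group_def)

lemma normal_unit_group: "unit_group V \<lhd> field_mult_group"
proof -
  interpret comm_group "field_mult_group :: 'a monoid" by (rule comm_group_field_mult)
  have "subgroup (unit_group V) field_mult_group"
  proof (rule subgroupI)
    fix u assume u: "u \<in> unit_group V"
    then have "inv\<^bsub>field_mult_group\<^esub> u = inverse u"
      using unit_group_nonzero[OF u] by (intro inv_equality) (auto simp: field_mult_group_def)
    then show "inv\<^bsub>field_mult_group\<^esub> u \<in> unit_group V" using unit_group_inverse[OF u] by simp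
  qed (use unit_group_one unit_group_mult unit_group_nonzero in \<open>auto simp: field_mult_group_def\<close>)
  then show ?thesis by (rule subgroup_imp_normal)
qed

lemma val_eq_r_coset: "val V x = unit_group V #>\<^bsub>field_mult_group\<^esub> x"
  unfolding val_def r_coset_def by (auto simp: field_mult_group_def)

lemma carrier_value_group: "carrier (value_group V) = val V ` (- {0})"
  unfolding value_group_def FactGroup_def RCOSETS_def val_eq_r_coset
  by (auto simp: field_mult_group_def)

lemma group_value_group: "group (value_group V)"
  unfolding value_group_def by (rule normal.factorgroup_is_group[OF normal_unit_group])

lemma value_group_one: "\<one>\<^bsub>value_group V\<^esub> = val V 1"
  unfolding value_group_def FactGroup_def val_def by simp

lemma value_group_mult:
  assumes "x \<noteq> 0" "y \<noteq> 0"
  shows "val V x \<otimes>\<^bsub>value_group V\<^esub> val V y = val V (x * y)"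
  unfolding value_group_def val_eq_r_coset FactGroup_def
  using normal.rcos_sum[OF normal_unit_group, of x y] assms by (simp add: field_mult_group_def)

lemma value_group_inv:
  assumes "x \<noteq> 0"
  shows "inv\<^bsub>value_group V\<^esub> (val V x) = val V (inverse x)"
  using assms carrier_value_group
  by (intro group.inv_equality[OF group_value_group]) (auto simp: value_group_mult value_group_one)

lemma subgroup_value_group:
  assumes "1 \<in> A" "0 \<notin> A" "\<And>x y. x \<in> A \<Longrightarrow> y \<in> A \<Longrightarrow> x * y \<in> A" "\<And>x. x \<in> A \<Longrightarrow> inverse x \<in> A"
  shows "subgroup (val V ` A) (value_group V)"
proof (rule group.subgroupI[OF group_value_group])
  show "val V ` A \<subseteq> carrier (value_group V)" unfolding carrier_value_group using assms(2) by blast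
  show "val V ` A \<noteq> {}" using assms(1) by blast
  fix a assume "a \<in> val V ` A"
  then obtain x where x: "x \<in> A" "a = val V x" by blast
  then have x0: "x \<noteq> 0" using assms(2) by blast
  show "inv\<^bsub>value_group V\<^esub> a \<in> val V ` A" using x x0 value_group_inv assms(4) by auto
  fix b assume "b \<in> val V ` A"
  then obtain y where y: "y \<in> A" "b = val V y" by blast
  then have y0: "y \<noteq> 0" using assms(2) by blast
  show "a \<otimes>\<^bsub>value_group V\<^esub> b \<in> val V ` A"
    using x y value_group_mult[OF x0 y0] assms(3) by auto
qed

text \<open>The convex subgroup generated by \<open>v d\<close> is not trivial. In rank one the
  trivial subgroup is the only proper convex one, so that subgroup is everything and
  \<open>v x\<close> is at most some multiple of \<open>v d\<close>.\<close>

lemma archimedean: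
  assumes rank: "valuation_rank V = 1" and d: "vless 1 d" and "x \<noteq> 0"
  shows "\<exists>n. d ^ n / x \<in> V"
proof -
  \<comment> \<open>The elements with value between \<open>- n * v d\<close> and
    \<open>n * v d\<close> for some \<open>n\<close>.\<close>
  define A where "A = {x. x \<noteq> 0 \<and> (\<exists>n. x * d ^ n \<in> V \<and> d ^ n / x \<in> V)}"
  define \<C> where "\<C> = {H. convex_subgroup V H \<and> H \<noteq> carrier (value_group V)}"
  have d0: "d \<noteq> 0" and dV: "d \<in> V" using vless_nonzero[OF d] vless_mem[OF d] by auto
  have card: "card \<C> = 1"
    using rank unfolding valuation_rank_def \<C>_def[symmetric]
    by (auto simp: Let_def one_enat_def split: if_splits)
  have dne: "val V d \<noteq> val V 1"
    using val_less_iff[of 1 d] d d0 unfolding val_less_def by auto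
  have conv: "convex_subgroup V (val V ` B)"
    if B: "subgroup (val V ` B) (value_group V)" "0 \<notin> B"
      "\<And>x y z. x \<in> B \<Longrightarrow> z \<in> B \<Longrightarrow> y \<noteq> 0 \<Longrightarrow> y / x \<in> V \<Longrightarrow> z / y \<in> V \<Longrightarrow> val V y \<in> val V ` B" for B
    unfolding convex_subgroup_def
  proof (intro conjI ballI impI)
    fix \<alpha> \<gamma> \<beta> assume h: "\<alpha> \<in> val V ` B" "\<gamma> \<in> val V ` B" "\<beta> \<in> carrier (value_group V)"
      "val_le V \<alpha> \<beta> \<and> val_le V \<beta> \<gamma>"
    then obtain x y z where xyz: "x \<in> B" "\<alpha> = val V x" "z \<in> B" "\<gamma> = val V z" "y \<noteq> 0" "\<beta> = val V y"
      unfolding carrier_value_group by auto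
    then have "x \<noteq> 0" using B(2) by blast
    have "y / x \<in> V" "z / y \<in> V"
      using h(4) xyz val_le_iff \<open>x \<noteq> 0\<close> unfolding vless_def by blast+
    then show "\<beta> \<in> val V ` B" using B(3) xyz by blast
  qed (rule B(1))
  have triv: "val V ` {1} \<in> \<C>"
  proof -
    have "convex_subgroup V (val V ` {1})"
    proof (rule conv)
      show "subgroup (val V ` {1}) (value_group V)" by (rule subgroup_value_group) auto
      fix x y z assume "x \<in> {1}" "z \<in> {1}" "y \<noteq> (0::'a)" "y / x \<in> V" "z / y \<in> V"
      then have "y \<in> unit_group V" unfolding unit_group_def by (simp add: inverse_eq_divide)
      then show "val V y \<in> val V ` {1}" using val_eq_iff[of y 1] by auto
    qed simp
    moreover have "val V d \<in> carrier (value_group V)" using d0 carrier_value_group by auto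
    ultimately show ?thesis unfolding \<C>_def using dne by auto
  qed
  have "convex_subgroup V (val V ` A)"
  proof (rule conv)
    show "subgroup (val V ` A) (value_group V)"
    proof (rule subgroup_value_group)
      show "1 \<in> A" unfolding A_def by (auto intro: exI[of _ 0])
      show "0 \<notin> A" unfolding A_def by simp
      show "inverse x \<in> A" if "x \<in> A" for x
        using that unfolding A_def by (auto simp: field_simps)
      show "x * y \<in> A" if xy: "x \<in> A" "y \<in> A" for x y
      proof -
        obtain n m where h: "x * d ^ n \<in> V" "d ^ n / x \<in> V" "y * d ^ m \<in> V" "d ^ m / y \<in> V" "x \<noteq> 0" "y \<noteq> 0"
          using xy unfolding A_def by blast
        have "x * y * d ^ (n + m) \<in> V" "d ^ (n + m) / (x * y) \<in> V"
          using mult_mem[OF h(1,3)] mult_mem[OF h(2,4)] by (simp_all add: power_add mult_ac)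
        then show ?thesis unfolding A_def using h by auto
      qed
    qed
    show "0 \<notin> A" unfolding A_def by simp
    fix x y z assume h: "x \<in> A" "z \<in> A" "y \<noteq> 0" "y / x \<in> V" "z / y \<in> V"
    then obtain n m where nm: "x * d ^ n \<in> V" "d ^ m / z \<in> V" "x \<noteq> 0" "z \<noteq> 0"
      unfolding A_def by blast
    have "y * d ^ n \<in> V" "d ^ m / y \<in> V"
      using mult_mem[OF h(4) nm(1)] mult_mem[OF h(5) nm(2)] nm by simp_all
    \<comment> \<open>Both bounds are weakened to the common exponent \<open>n + m\<close>, which is
      possible because \<open>d\<close> lies in \<open>V\<close>.\<close>
    then have "y * d ^ n * d ^ m \<in> V" "d ^ m / y * d ^ n \<in> V" using power_mem[OF dV] mult_mem by blast+
    then have "y * d ^ (n + m) \<in> V" "d ^ (n + m) / y \<in> V" by (simp_all add: power_add mult_ac)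
    then show "val V y \<in> val V ` A" unfolding A_def using h(3) by blast
  qed
  moreover have "val V d \<in> val V ` A"
    unfolding A_def using d0 dV mult_mem by (auto intro!: imageI exI[of _ 1])
  then have "val V ` A \<noteq> val V ` {1}" using dne by auto
  then have "val V ` A \<notin> \<C>" using card triv by (metis card_1_singletonE singletonD)
  ultimately have "val V ` A = carrier (value_group V)" unfolding \<C>_def by blast
  then have "val V x \<in> val V ` A" using \<open>x \<noteq> 0\<close> carrier_value_group by auto
  then obtain y where "y \<in> A" "val V y = val V x" by auto
  then obtain u n where "u \<in> unit_group V" "y = u * x" "d ^ n / y \<in> V"
    using val_eq_iff unfolding A_def by blast
  then have "d ^ n / x = u * (d ^ n / y)" "u \<in> unit_group V" "d ^ n / y \<in> V"
    using unit_group_nonzero by auto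
  then show ?thesis using unit_mult_mem_iff by metis
qed

text \<open>Division with remainder by \<open>v d\<close>: the archimedean property bounds
  \<open>v x\<close> by multiples of \<open>v d\<close> on both sides, and walking up from the lower
  bound finds \<open>(m - 1) * v d \<le> v x < m * v d\<close>.\<close>

lemma archimedean_interval:
  assumes rank: "valuation_rank V = 1" and d: "vless 1 d" and x: "x \<noteq> 0"
  shows "\<exists>m::int. vless x (d powi m) \<and> \<not> vless x (d powi (m - 1))"
proof -
  have d0: "d \<noteq> 0" and dV: "d \<in> V" using vless_nonzero[OF d] vless_mem[OF d] by auto
  obtain n where n: "d ^ n / inverse x \<in> V" using archimedean[OF rank d] x by (metis inverse_nonzero_iff_nonzero)
  obtain k where k: "d ^ k / x \<in> V" using archimedean[OF rank d x] by blast
  \<comment> \<open>The shift by \<open>n\<close> starts the search at the lower bound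
    \<open>- n * v d \<le> v x\<close>. From \<open>v x \<le> k * v d\<close> the strict bound
    follows only at exponent \<open>k + 1\<close>, hence the index
    \<open>Suc (k + n)\<close>.\<close>
  define P where "P j \<longleftrightarrow> vless x (d powi (int j - int n))" for j :: nat
  have "\<not> P 0" using n x d0 unfolding P_def vless_def by (simp add: power_int_minus divide_inverse mult.commute)
  moreover have "P (Suc (k + n))"
    unfolding P_def vless_def
  proof
    assume "x / d powi (int (Suc (k + n)) - int n) \<in> V"
    moreover have "int (Suc (k + n)) - int n = int (Suc k)" by simp
    ultimately have "x / d ^ Suc k \<in> V" by (metis power_int_of_nat)
    then have "x / d ^ Suc k * (d ^ k / x) \<in> V" using k mult_mem by blast
    then show False using d x d0 unfolding vless_def by simp
  qed
  ultimately obtain j where j: "\<not> P j" "P (Suc j)"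
    using inc_induct dec_induct[of 0 "Suc (k + n)" "\<lambda>j. \<not> P j"] by blast
  show ?thesis
    using j unfolding P_def by (intro exI[of _ "int (Suc j) - int n"]) (simp add: algebra_simps)
qed

text \<open>If \<open>v d\<close> were the least positive value, the value group would be infinite cyclic.\<close>

lemma exists_half:
  assumes rank: "valuation_rank V = 1" and unc: "uncountable (carrier (value_group V))" and d: "vless 1 d"
  shows "\<exists>e. vless 1 e \<and> \<not> vless d (e\<^sup>2)"
proof -
  have d0: "d \<noteq> 0" using vless_nonzero[OF d] by auto
  have "\<exists>e. vless 1 e \<and> vless e d"
  proof (rule ccontr)
    assume no: "\<not> (\<exists>e. vless 1 e \<and> vless e d)"
    have "val V x \<in> range (\<lambda>m. val V (d powi m))" if x: "x \<noteq> 0" for x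
    proof -
      obtain m where m: "vless x (d powi m)" "\<not> vless x (d powi (m - 1))"
        using archimedean_interval[OF rank d x] by blast
      \<comment> \<open>The value of \<open>x / y\<close> lies between 0 and \<open>v d\<close>,
        with \<open>v d\<close> excluded, so it must be 0.\<close>
      define y where "y = d powi (m - 1)"
      have y0: "y \<noteq> 0" and dy: "d powi m = y * d"
        using d0 by (simp_all add: y_def power_int_diff)
      have "vless (x / y) d" using m(1) unfolding dy vless_def by simp
      then have "\<not> vless 1 (x / y)" using no by blast
      then have yx: "\<not> vless y x" unfolding vless_def by simp
      have xy: "\<not> vless x y" using m(2) unfolding y_def .
      have "val V x = val V y"
        using val_eqI[OF x y0 xy yx] .
      then show ?thesis unfolding y_def by blast
    qed
    then have "carrier (value_group V) \<subseteq> range (\<lambda>m. val V (d powi m))"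
      unfolding carrier_value_group by auto
    then show False using unc countable_subset[OF _ countable_image[OF countableI_type]] by metis
  qed
  then obtain e where e: "vless 1 e" "vless e d" by blast
  have e0: "e \<noteq> 0" using vless_nonzero e by blast
  show ?thesis
  \<comment> \<open>The values of \<open>e\<close> and \<open>d / e\<close> are positive and add up
    to \<open>v d\<close>, so one of them is at most half of it.\<close>
  proof (cases "vless d (e\<^sup>2)")
    case False
    then show ?thesis using e by blast
  next
    case True
    have "vless 1 (d / e)" using e(2) by (simp add: vless_def)
    moreover have "d / (d / e)\<^sup>2 = e\<^sup>2 / d" using d0 e0 by (simp add: field_simps power2_eq_square)
    ultimately show ?thesis using vless_mem[OF True] unfolding vless_def by metis
  qed
qed

text \<open>Iterated halving gives \<open>2 ^ n * v (d n) \<le> v (d 0)\<close>. A positive lower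
  bound \<open>v e\<close> of all \<open>v (d n)\<close> would give
  \<open>2 ^ n * v e \<le> v (d 0)\<close> for every \<open>n\<close>, against the archimedean
  property.\<close>

lemma exists_null_sequence:
  assumes rank: "valuation_rank V = 1" and unc: "uncountable (carrier (value_group V))"
  shows "\<exists>d. nondiscrete_valued_field V d"
proof -
  have ex: "\<exists>e. vless 1 e"
  proof (rule ccontr)
    assume no: "\<not> (\<exists>e. vless 1 e)"
    have "val V x = val V 1" if x: "x \<noteq> 0" for x
    proof -
      have "\<not> vless 1 x" "\<not> vless 1 (1 / x)" using no by blast+
      then have "\<not> vless 1 x" "\<not> vless x 1" unfolding vless_def by simp_all
      then show ?thesis using x by (intro val_eqI) simp_all
    qed
    then have "carrier (value_group V) \<subseteq> {val V 1}" unfolding carrier_value_group by blast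
    from countable_subset[OF this] show False using unc by simp
  qed
  have "\<exists>d. \<forall>n. vless 1 (d n) \<and> \<not> vless (d n) ((d (Suc n))\<^sup>2)"
  proof (rule dependent_nat_choice[of "\<lambda>_. vless 1" "\<lambda>_ x y. \<not> vless x (y\<^sup>2)"])
    show "\<exists>e. vless 1 e \<and> \<not> vless x (e\<^sup>2)" if "vless 1 x" for x and n :: nat
      by (rule exists_half[OF rank unc that])
  qed (rule ex)
  then obtain d :: "nat \<Rightarrow> 'a" where pos: "\<And>n. vless 1 (d n)"
    and half: "\<And>n. \<not> vless (d n) ((d (Suc n))\<^sup>2)"
    by blast
  have nz: "d n \<noteq> 0" for n using vless_nonzero[OF pos[of n]] by simp
  have dec: "vless (d (Suc n)) (d n)" for n
    unfolding vless_def
  proof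
    assume "d (Suc n) / d n \<in> V"
    then have "d (Suc n) / d n * (d n / (d (Suc n))\<^sup>2) \<in> V"
      using half[of n] mult_mem unfolding vless_def by blast
    then show False using pos[of "Suc n"] nz[of n] nz[of "Suc n"]
      by (simp add: vless_def power2_eq_square)
  qed
  have pow: "d 0 / d n ^ (2 ^ n) \<in> V" for n
  proof (induction n)
    case 0
    show ?case using nz[of 0] by simp
  next
    case (Suc n)
    have "(d n / (d (Suc n))\<^sup>2) ^ (2 ^ n) \<in> V" using half[of n] power_mem unfolding vless_def by blast
    then have "d 0 / d n ^ (2 ^ n) * (d n / (d (Suc n))\<^sup>2) ^ (2 ^ n) \<in> V" using Suc mult_mem by blast
    moreover have "d 0 / d n ^ (2 ^ n) * (d n / (d (Suc n))\<^sup>2) ^ (2 ^ n) = d 0 / d (Suc n) ^ (2 ^ Suc n)"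
      unfolding power_divide power_mult[symmetric] power_Suc using nz[of n] by simp
    ultimately show ?case by (simp only:)
  qed
  have null: "\<exists>n. vless (d n) e" if e: "vless 1 e" for e
  proof (rule ccontr)
    assume no: "\<not> (\<exists>n. vless (d n) e)"
    have e0: "e \<noteq> 0" using vless_nonzero[OF e] by simp
    \<comment> \<open>The exponent bounding \<open>v (d 0)\<close> by \<open>n * v e\<close> is also
      used as the index of the sequence; the contradiction then comes from
      \<open>n < 2 ^ n\<close>.\<close>
    obtain n where n: "e ^ n / d 0 \<in> V" using archimedean[OF rank e nz] by blast
    have "(d n / e) ^ (2 ^ n) \<in> V" using no power_mem unfolding vless_def by blast
    then have "d 0 / d n ^ (2 ^ n) * (d n / e) ^ (2 ^ n) \<in> V" using pow mult_mem by blast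
    then have "d 0 / e ^ (2 ^ n) \<in> V" using nz[of n] by (simp add: power_divide)
    then have "e ^ n / d 0 * (d 0 / e ^ (2 ^ n)) \<in> V" using n mult_mem by blast
    moreover have "e ^ n / d 0 * (d 0 / e ^ (2 ^ n)) = (1 / e) ^ (2 ^ n - n)"
    proof -
      have "e ^ (2 ^ n) = e ^ n * e ^ (2 ^ n - n)"
        using power_add[of e n "2 ^ n - n"] less_exp[of n] by simp
      then show ?thesis using nz[of 0] e0 by (simp add: power_divide)
    qed
    ultimately have "(1 / e) ^ (2 ^ n - n) \<in> V" by simp
    then have "1 / e \<in> V" by (rule root_mem) simp
    then show False using e unfolding vless_def by blast
  qed
  show ?thesis
    using valued_field_axioms pos dec null
    unfolding nondiscrete_valued_field_def nondiscrete_valued_field_axioms_def by blast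
qed

end

section \<open>Countable order density and the conclusion\<close>

context nondiscrete_valued_field
begin

text \<open>With \<open>v (d k) < v c - v t\<close>, the first multiple of \<open>v (d k)\<close>
  above \<open>v t\<close> is at most \<open>v t + v (d k)\<close> and so does not pass
  \<open>v c\<close>.\<close>

lemma countable_order_dense:
  assumes rank: "valuation_rank V = 1" and tc: "vless t c"
  shows "\<exists>c'\<in>range (\<lambda>(k, m::int). d k powi m). vless t c' \<and> \<not> vless c c'"
proof -
  have nz: "t \<noteq> 0" "c \<noteq> 0" using vless_nonzero[OF tc] by auto
  have "vless 1 (c / t)" using tc by (simp add: vless_def)
  then obtain k where k: "vless (d k) (c / t)" using d_null by blast
  obtain m where m: "vless t (d k powi m)" "\<not> vless t (d k powi (m - 1))"
    using archimedean_interval[OF rank d_pos nz(1)] by blast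
  have "c / t / d k * (t / d k powi (m - 1)) \<in> V"
    using m(2) vless_mem[OF k] mult_mem unfolding vless_def by blast
  moreover have "c / t / d k * (t / d k powi (m - 1)) = c / d k powi m"
    using nz by (simp add: power_int_diff)
  ultimately have "\<not> vless c (d k powi m)" by (simp add: vless_def)
  then show ?thesis using m(1) by (intro bexI[of _ "d k powi m"]) auto
qed

lemma not_metrizable:
  assumes rank: "valuation_rank V = 1" and unc: "uncountable (carrier (value_group V))"
  shows "\<not> metrizable_space (subtopology (zariski_topology V) (pc_domains V))
       \<and> \<not> metrizable_space (constructible_topology V)"
proof -
  let ?C = "range (\<lambda>(k, m::int). d k powi m)"
  have vals: "\<not> countable (val V ` (- {0}))" using unc carrier_value_group by simp
  have "countable ?C" by (rule countable_image[OF countableI_type])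
  note C = this countable_order_dense[OF rank]
  have Z: "openin (zariski_topology V) (Zar_B V \<phi>)" for \<phi>
    unfolding zariski_topology_def by (rule topology_generated_by_Basis) simp
  have "openin (constructible_topology V) (\<Inter>\<psi>\<in>{\<phi>}. Zar_B V \<psi>)" for \<phi>
    unfolding constructible_topology_def
    by (rule topology_generated_by_Basis, rule UN_I[of "{\<phi>}"]) simp_all
  then have Zc: "openin (constructible_topology V) (Zar_B V \<phi>)" for \<phi> by simp
  show ?thesis
  proof (intro conjI notI)
    assume "metrizable_space (subtopology (zariski_topology V) (pc_domains V))"
    from metrizable_imp_countable_values[OF this cut_domain_in_pc_domains left_open_zariski Z C]
    show False using vals by simp
  next
    assume "metrizable_space (constructible_topology V)"
    \<comment> \<open>Taking all of \<open>UNIV\<close> as the subspace brings the whole space into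
      the form shared with the Zariski case.\<close>
    then have "metrizable_space (subtopology (constructible_topology V) UNIV)" by simp
    from metrizable_imp_countable_values[OF this _ left_open_constructible Zc C]
    show False using vals by simp
  qed
qed

end

theorem corollary4p8:
  fixes V :: "'a::field set"
  assumes "valuation_domain V"
    and "valuation_rank V = 1"
    and "uncountable (carrier (value_group V))"
  shows "\<not> metrizable_space (subtopology (zariski_topology V) (pc_domains V))
       \<and> \<not> metrizable_space (constructible_topology V)"
proof -
  have "valued_field V" by (rule valued_field.intro) (rule assms(1))
  from valued_field.exists_null_sequence[OF this assms(2,3)]
  obtain d where "nondiscrete_valued_field V d" by blast
  then show ?thesis by (rule nondiscrete_valued_field.not_metrizable) (rule assms(2,3))+
qed

end
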